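(* Let $G$ be a connected graph with vertex set $\{1,\dots,n\}$, $n\ge 2$, let $\Phi=(F_1,\dots,F_n)$ be an $n$-tuple of pairwise disjoint graphs with $|V(F_i)|\ge 2$ for all $i$, and let $G[\Phi]$ be the generalized lexicographic product. Then (i) $\gamma(G[\Phi])=\gamma_r(G[\Phi])=\gamma^{oc}(G[\Phi])$, and (ii) $\gamma_t(G)=\gamma_t(G[\Phi])=\gamma_{tr}(G[\Phi])=\gamma_t^{oc}(G[\Phi])$.
   Context: All graphs are finite, simple and undirected. The generalized lexicographic product $G[\Phi]$ is the graph with vertex set $\bigcup_{i=1}^n V(F_i)$ in which each $F_i$ is an induced subgraph, and for $x\in V(F_i)$, $y\in V(F_j)$ with $i\neq j$, $xy$ is an edge iff $ij\in E(G)$. For a graph $H$ and $S\subseteq V(H)$: $S$ is dominating if every vertex outside $S$ has a neighbor in $S$; total dominating if every vertex of $H$ has a neighbor in $S$; a dominating set $S$ is restrained if every vertex outside $S$ has a neighbor outside $S$, and outer-connected if the subgraph induced by $V(H)\setminus S$ is connected. $\gamma,\gamma_t,\gamma_r,\gamma_{tr},\gamma^{oc},\gamma_t^{oc}$ denote the minimum cardinalities of, respectively, dominating, total dominating, restrained dominating, total restrained dominating (total and restrained), outer-connected dominating, and total outer-connected dominating (total and outer-connected) sets. *)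

theory Defs
  imports "Graph_Theory.Graph_Theory" "HOL-Library.Extended_Nat" "HOL-Library.Disjoint_Sets"
begin

text \<open>
  Finite simple undirected graphs are the \<^locale>\<open>pair_graph\<close>s of the library: an edge
  between \<open>u\<close> and \<open>v\<close> is the pair of arcs \<open>(u, v)\<close>, \<open>(v, u)\<close> in \<^const>\<open>parcs\<close>.
\<close>

definition lex_product :: "'i pair_pre_digraph \<Rightarrow> ('i \<Rightarrow> 'a pair_pre_digraph) \<Rightarrow> 'a pair_pre_digraph"
where
  "lex_product G F =
    \<lparr> pverts = (\<Union>i\<in>pverts G. pverts (F i)),
      parcs = (\<Union>i\<in>pverts G. parcs (F i)) \<union> (\<Union>(i, j)\<in>parcs G. pverts (F i) \<times> pverts (F j)) \<rparr>"

definition dominating_set :: "'a pair_pre_digraph \<Rightarrow> 'a set \<Rightarrow> bool" where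
  "dominating_set H S \<longleftrightarrow>
    S \<subseteq> pverts H \<and> (\<forall>v\<in>pverts H - S. \<exists>u\<in>S. (v, u) \<in> parcs H)"

definition total_dominating_set :: "'a pair_pre_digraph \<Rightarrow> 'a set \<Rightarrow> bool" where
  "total_dominating_set H S \<longleftrightarrow>
    S \<subseteq> pverts H \<and> (\<forall>v\<in>pverts H. \<exists>u\<in>S. (v, u) \<in> parcs H)"

definition restrained :: "'a pair_pre_digraph \<Rightarrow> 'a set \<Rightarrow> bool" where
  "restrained H S \<longleftrightarrow> (\<forall>v\<in>pverts H - S. \<exists>u\<in>pverts H - S. (v, u) \<in> parcs H)"

text \<open>
  The library's \<^const>\<open>Digraph_Component.connected\<close> excludes the graph without vertices, so an
  outer-connected set is a proper subset of the vertex set.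
\<close>

definition outer_connected :: "'a pair_pre_digraph \<Rightarrow> 'a set \<Rightarrow> bool" where
  "outer_connected H S \<longleftrightarrow> Digraph_Component.connected (with_proj H \<restriction> (pverts H - S))"

text \<open>The value is \<open>\<infinity>\<close> if no set satisfies \<open>P\<close>; otherwise the infimum is attained.\<close>

definition min_card :: "('a set \<Rightarrow> bool) \<Rightarrow> enat" where
  "min_card P = (INF S\<in>{S. P S}. enat (card S))"

definition dom_number :: "'a pair_pre_digraph \<Rightarrow> enat" (\<open>\<gamma>\<close>) where
  "\<gamma> H = min_card (dominating_set H)"

definition total_dom_number :: "'a pair_pre_digraph \<Rightarrow> enat" (\<open>\<gamma>\<^sub>t\<close>) where
  "\<gamma>\<^sub>t H = min_card (total_dominating_set H)"

definition restrained_dom_number :: "'a pair_pre_digraph \<Rightarrow> enat" (\<open>\<gamma>\<^sub>r\<close>) where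
  "\<gamma>\<^sub>r H = min_card (\<lambda>S. dominating_set H S \<and> restrained H S)"

definition total_restrained_dom_number :: "'a pair_pre_digraph \<Rightarrow> enat" (\<open>\<gamma>\<^sub>t\<^sub>r\<close>) where
  "\<gamma>\<^sub>t\<^sub>r H = min_card (\<lambda>S. total_dominating_set H S \<and> restrained H S)"

definition oc_dom_number :: "'a pair_pre_digraph \<Rightarrow> enat" (\<open>\<gamma>\<^sup>o\<^sup>c\<close>) where
  "\<gamma>\<^sup>o\<^sup>c H = min_card (\<lambda>S. dominating_set H S \<and> outer_connected H S)"

definition total_oc_dom_number :: "'a pair_pre_digraph \<Rightarrow> enat" (\<open>\<gamma>\<^sub>t\<^sup>o\<^sup>c\<close>) where
  "\<gamma>\<^sub>t\<^sup>o\<^sup>c H = min_card (\<lambda>S. total_dominating_set H S \<and> outer_connected H S)"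

end

theory Submission
  imports Defs
begin

text \<open>
  Write \<open>V\<^sub>i\<close> for the vertex set of \<open>F\<^sub>i\<close>, and call a set \<open>S\<close> thin if it contains no \<open>V\<^sub>i\<close>. Every
  walk in \<open>G\<close> lifts to the complement of a thin set, so thin sets are both restrained and
  outer-connected. Hence it suffices to replace any (total) dominating set by a thin one that is
  not larger. In a dominating set, a contained \<open>V\<^sub>i\<close> has at least two vertices and can be replaced
  by one of its vertices together with at most one vertex of a neighbouring \<open>V\<^sub>j\<close>. For a total
  dominating set \<open>S\<close> of the product, the indices \<open>i\<close> with \<open>V\<^sub>i\<close> meeting \<open>S\<close>, together with a
  neighbour of each \<open>i\<close> such that \<open>V\<^sub>i\<close> meets \<open>S\<close> at least twice, form a total dominating set of
  \<open>G\<close>; conversely one vertex from each \<open>V\<^sub>i\<close> lifts a total dominating set of \<open>G\<close> to a thin one.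
\<close>

section \<open>Comparison of minimum cardinalities\<close>

lemma min_card_le:
  assumes "\<And>S. Q S \<Longrightarrow> \<exists>T. P T \<and> card T \<le> card S"
  shows "min_card P \<le> min_card Q"
  unfolding min_card_def using assms by (intro INF_mono) (metis enat_ord_simps(1) mem_Collect_eq)

lemma min_card_mono:
  assumes "\<And>S. Q S \<Longrightarrow> P S"
  shows "min_card P \<le> min_card Q"
  using assms by (intro min_card_le) blast

text \<open>One stronger property \<open>R\<close> serves several \<open>Q\<close>: with
  \<open>thin\<close> as \<open>R\<close>, a single replacement argument gives both the restrained
  and the outer-connected equation.\<close>

lemma min_card_subpredicate_eq:
  assumes "\<And>S. P S \<Longrightarrow> \<exists>T. P T \<and> R T \<and> card T \<le> card S" and "\<And>S. R S \<Longrightarrow> Q S"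
  shows "min_card P = min_card (\<lambda>S. P S \<and> Q S)"
proof (rule antisym)
  show "min_card (\<lambda>S. P S \<and> Q S) \<le> min_card P"
    using assms by (intro min_card_le) blast
qed (auto intro: min_card_mono)

section \<open>Blocks and adjacency in the product\<close>

locale lex_product_graph =
  fixes G :: "'i pair_pre_digraph" and F :: "'i \<Rightarrow> 'a pair_pre_digraph"
  assumes graph_G: "pair_graph G"
    and card_G: "card (pverts G) \<ge> 2"
    and connected_G: "Digraph_Component.connected (with_proj G)"
    and graph_F: "i \<in> pverts G \<Longrightarrow> pair_graph (F i)"
    and disjoint_F: "disjoint_family_on (\<lambda>i. pverts (F i)) (pverts G)"
    and card_F: "i \<in> pverts G \<Longrightarrow> card (pverts (F i)) \<ge> 2"
begin

interpretation G: pair_graph G by (rule graph_G)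

abbreviation H :: "'a pair_pre_digraph" where
  "H \<equiv> lex_product G F"

abbreviation V :: "'i \<Rightarrow> 'a set" where
  "V i \<equiv> pverts (F i)"

definition idx :: "'a \<Rightarrow> 'i" where
  "idx x = (THE i. i \<in> pverts G \<and> x \<in> V i)"

definition thin :: "'a set \<Rightarrow> bool" where
  "thin S \<longleftrightarrow> (\<forall>i\<in>pverts G. \<not> V i \<subseteq> S)"

lemma idx_eq: "i \<in> pverts G \<Longrightarrow> x \<in> V i \<Longrightarrow> idx x = i"
  unfolding idx_def using disjoint_F by (auto simp: disjoint_family_on_def)

text \<open>Outside the product \<open>idx\<close> has an unspecified value, hence the second
  conjunct.\<close>

lemma verts_H: "x \<in> pverts H \<longleftrightarrow> idx x \<in> pverts G \<and> x \<in> V (idx x)"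
  using idx_eq by (auto simp: lex_product_def)

lemma arc_H_between:
  assumes "(i, j) \<in> parcs G" "x \<in> V i" "y \<in> V j"
  shows "(x, y) \<in> parcs H"
  using assms by (auto simp: lex_product_def)

lemma arc_HE:
  assumes "(x, y) \<in> parcs H"
  obtains (inside) "idx x = idx y" "(x, y) \<in> parcs (F (idx x))"
    | (between) "(idx x, idx y) \<in> parcs G"
proof -
  from assms consider (a) i where "i \<in> pverts G" "(x, y) \<in> parcs (F i)"
    | (b) i j where "(i, j) \<in> parcs G" "x \<in> V i" "y \<in> V j"
    by (auto simp: lex_product_def)
  then show thesis
  proof cases
    case a
    interpret Fi: pair_graph "F i" using a graph_F by blast
    have "idx x = i" "idx y = i"
      using a Fi.in_arcsD1 Fi.in_arcsD2 idx_eq by blast+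
    with a inside show thesis by simp
  next
    case b
    then have "idx x = i" "idx y = j"
      using G.in_arcsD1 G.in_arcsD2 idx_eq by blast+
    with b between show thesis by simp
  qed
qed

lemma finite_H: "finite (pverts H)"
  \<comment> \<open>\<open>card\<close> is 0 on infinite sets, so \<open>card_F\<close> forces each
    \<open>V i\<close> to be finite.\<close>
  using G.pair_finite_verts card_F card.infinite by (fastforce simp: lex_product_def)

lemma ex_other:
  assumes "i \<in> pverts G"
  obtains x where "x \<in> V i" "x \<noteq> y"
proof -
  have "\<not> V i \<subseteq> {y}"
    using card_F[OF assms] card_mono[of "{y}" "V i"] by auto
  with that show thesis by blast
qed

text \<open>Positive length matters when \<open>i = j\<close>: two vertices of one block need not be
  adjacent and are joined along a closed walk of \<open>G\<close>, whose first arc also gives the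
  neighbour chosen by \<open>nb\<close>. A detour through some \<open>k\<close> other than
  \<open>i\<close> provides the walk.\<close>

lemma connected_trancl:
  assumes "i \<in> pverts G" "j \<in> pverts G"
  shows "(i, j) \<in> (parcs G)\<^sup>+"
proof -
  have reach: "(k, l) \<in> (parcs G)\<^sup>*" if "k \<in> pverts G" "l \<in> pverts G" for k l
  proof -
    have "strongly_connected (with_proj G)"
      using G.symmetric_connected_imp_strongly_connected G.pair_sym_arcs connected_G by blast
    then have "k \<rightarrow>\<^sup>*\<^bsub>with_proj G\<^esub> l"
      using that by (auto simp: strongly_connected_def)
    then show ?thesis
      using reachable_rtranclI by fastforce
  qed
  obtain k where k: "k \<in> pverts G" "k \<noteq> i"
  proof -
    have "\<not> pverts G \<subseteq> {i}"
      using card_G card_mono[of "{i}" "pverts G"] by auto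
    with that show thesis by blast
  qed
  have "(i, k) \<in> (parcs G)\<^sup>+"
    using reach[OF assms(1) k(1)] k(2) by (auto dest: rtranclD)
  then show ?thesis
    using reach[OF k(1) assms(2)] by (rule trancl_rtrancl_trancl)
qed

definition nb :: "'i \<Rightarrow> 'i" where
  "nb i = (SOME j. (i, j) \<in> parcs G)"

lemma arc_nb: "i \<in> pverts G \<Longrightarrow> (i, nb i) \<in> parcs G"
  unfolding nb_def using connected_trancl[of i i] by (metis someI_ex tranclD)

lemma nb_in: "i \<in> pverts G \<Longrightarrow> nb i \<in> pverts G"
  using arc_nb G.in_arcsD2 by blast

definition rep :: "'i \<Rightarrow> 'a" where
  "rep i = (SOME x. x \<in> V i)"

lemma rep_in: "i \<in> pverts G \<Longrightarrow> rep i \<in> V i"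
  unfolding rep_def by (metis ex_other someI_ex)

section \<open>Complements of thin sets\<close>

lemma thin_restrained:
  assumes "thin S"
  shows "restrained H S"
  unfolding restrained_def
proof
  fix v assume v: "v \<in> pverts H - S"
  then have i: "idx v \<in> pverts G" "v \<in> V (idx v)"
    by (auto simp: verts_H)
  obtain u where u: "u \<in> V (nb (idx v))" "u \<notin> S"
    using assms nb_in[OF i(1)] unfolding thin_def by blast
  have "u \<in> pverts H"
    using u idx_eq nb_in[OF i(1)] by (simp add: verts_H)
  with u i arc_H_between[OF arc_nb[OF i(1)]] show "\<exists>u\<in>pverts H - S. (v, u) \<in> parcs H"
    by blast
qed

lemma thin_outer_connected:
  assumes thin: "thin S"
  shows "outer_connected H S"
proof -
  let ?W = "pverts H - S"
  let ?K = "with_proj H \<restriction> ?W"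
  have wf: "wf_digraph ?K"
    by unfold_locales auto
  have V_W: "x \<in> ?W" if "i \<in> pverts G" "x \<in> V i - S" for i x
    using that idx_eq by (auto simp: verts_H)
  have arc: "(x, y) \<in> arcs_ends ?K"
    if "(i, j) \<in> parcs G" "x \<in> V i - S" "y \<in> V j - S" for i j x y
  proof -
    have "(x, y) \<in> parcs H"
      using that arc_H_between by blast
    moreover have "x \<in> ?W" "y \<in> ?W"
      using that V_W G.in_arcsD1 G.in_arcsD2 by blast+
    ultimately show ?thesis
      by (simp add: arcs_ends_conv rev_image_eqI)
  qed
  \<comment> \<open>All of \<open>V j - S\<close> is reached at once, so that the lifted walk may
    end anywhere in the last block; thinness supplies \<open>z\<close>, through which it passes the
    block before.\<close>
  have reach: "\<forall>y\<in>V j - S. (x, y) \<in> (arcs_ends ?K)\<^sup>+"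
    if "(i, j) \<in> (parcs G)\<^sup>+" "x \<in> V i - S" for i j x
    using that(1)
  proof induction
    case (base j)
    then show ?case
      using that(2) arc by blast
  next
    case (step j k)
    obtain z where z: "z \<in> V j - S"
      using thin step.hyps(2) G.in_arcsD1 unfolding thin_def by blast
    then show ?case
      using step.IH arc[OF step.hyps(2)] by (meson trancl.trancl_into_trancl)
  qed
  obtain i where "i \<in> pverts G"
    using card_G by fastforce
  \<comment> \<open>The graph without vertices does not count as connected, but a thin set leaves a
    vertex in every block.\<close>
  then have "?W \<noteq> {}"
    using thin V_W unfolding thin_def by blast
  moreover have "x \<rightarrow>\<^sup>*\<^bsub>with_proj (mk_symmetric ?K)\<^esub> y" if "x \<in> ?W" "y \<in> ?W" for x y
  proof -
    have "(x, y) \<in> (arcs_ends ?K)\<^sup>+"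
      using reach[OF connected_trancl] that by (auto simp: verts_H)
    then show ?thesis
      using wf wf_digraph.reachable1_reachable wf_digraph.reachable_mk_symmetricI by metis
  qed
  ultimately show ?thesis
    unfolding outer_connected_def by (intro wf_digraph.connectedI[OF wf]) simp_all
qed

section \<open>Thin dominating sets\<close>

lemma dominating_set_thin:
  assumes dom: "dominating_set H S"
  obtains T where "dominating_set H T" "thin T" "card T \<le> card S"
proof -
  have S_sub: "S \<subseteq> pverts H"
    using dom by (simp add: dominating_set_def)
  \<comment> \<open>In a full block \<open>V i \<subseteq> S\<close>, \<open>rep i\<close> stays and
    the surplus vertices all go to one place: to \<open>rep i\<close> if \<open>S\<close> already
    meets the neighbouring block, otherwise to \<open>rep (nb i)\<close>. All other vertices of
    \<open>S\<close> are fixed.\<close>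
  define g where "g v =
    (if V (idx v) \<subseteq> S
     then if v = rep (idx v) \<or> S \<inter> V (nb (idx v)) \<noteq> {} then rep (idx v) else rep (nb (idx v))
     else v)" for v
  let ?T = "g ` S"
  have S_idx: "idx v \<in> pverts G" "v \<in> V (idx v)" if "v \<in> S" for v
    using that S_sub by (auto simp: verts_H)
  \<comment> \<open>Blocks met by \<open>S\<close> stay met by \<open>?T\<close>, so domination
    across two blocks survives.\<close>
  have meets: "\<exists>u\<in>?T. u \<in> V j" if "j \<in> pverts G" "u \<in> S" "u \<in> V j" for j u
  proof (cases "V j \<subseteq> S")
    case True
    then have "g (rep j) = rep j" "rep j \<in> S"
      using rep_in[OF that(1)] idx_eq[OF that(1)] by (auto simp: g_def)
    then show ?thesis
      using rep_in[OF that(1)] by (metis imageI)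
  next
    case False
    then have "g u = u"
      using idx_eq that by (simp add: g_def)
    then show ?thesis
      using that by (metis imageI)
  qed
  have "?T \<subseteq> pverts H"
  proof
    fix x assume "x \<in> ?T"
    then obtain v where v: "v \<in> S" "x = g v" by blast
    have "rep i \<in> pverts H" if "i \<in> pverts G" for i
      using that rep_in idx_eq by (simp add: verts_H)
    then show "x \<in> pverts H"
      using v S_idx[OF v(1)] S_sub nb_in by (auto simp: g_def)
  qed
  moreover have "\<exists>u\<in>?T. (v, u) \<in> parcs H" if v: "v \<in> pverts H - ?T" for v
  proof (cases "v \<in> S")
    case True
    let ?k = "idx v"
    have k: "?k \<in> pverts G" "v \<in> V ?k"
      using v by (auto simp: verts_H)
    \<comment> \<open>Only a surplus vertex of a full block can drop out; it is then dominated from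
      the neighbouring block.\<close>
    have full: "V ?k \<subseteq> S" and "v \<noteq> rep ?k"
      using v True by (force simp: g_def)+
    have "\<exists>u\<in>?T. u \<in> V (nb ?k)"
    proof (cases "S \<inter> V (nb ?k) = {}")
      case True
      then have "g v = rep (nb ?k)"
        using full \<open>v \<noteq> rep ?k\<close> by (simp add: g_def)
      then show ?thesis
        using rep_in nb_in k \<open>v \<in> S\<close> by (metis imageI)
    next
      case False
      then show ?thesis
        using meets nb_in k by blast
    qed
    then show ?thesis
      using arc_H_between[OF arc_nb[OF k(1)] k(2)] by blast
  next
    case False
    let ?k = "idx v"
    have k: "?k \<in> pverts G" "v \<in> V ?k"
      using v by (auto simp: verts_H)
    obtain u where u: "u \<in> S" "(v, u) \<in> parcs H"
      using dom v False unfolding dominating_set_def by blast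
    from u(2) show ?thesis
    proof (cases rule: arc_HE)
      case inside
      \<comment> \<open>As \<open>v\<close> is not in \<open>S\<close>, the common block of
        \<open>u\<close> and \<open>v\<close> is not full.\<close>
      then have "g u = u"
        using False k by (auto simp: g_def)
      with u show ?thesis by (metis imageI)
    next
      case between
      then show ?thesis
        using meets[OF S_idx(1)[OF u(1)] u(1) S_idx(2)[OF u(1)]] arc_H_between k by blast
    qed
  qed
  ultimately have "dominating_set H ?T"
    by (simp add: dominating_set_def)
  moreover have "thin ?T"
    unfolding thin_def
  proof
    fix k assume k: "k \<in> pverts G"
    \<comment> \<open>Vertices are sent into \<open>V k\<close> from another block only if
      \<open>S\<close> misses \<open>V k\<close>, and then only to \<open>rep k\<close>.\<close>
    have T_cases: "(x \<in> S \<and> \<not> V k \<subseteq> S) \<or> (x = rep k \<and> (V k \<subseteq> S \<or> S \<inter> V k = {}))"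
      if x: "x \<in> ?T" "x \<in> V k" for x
    proof -
      obtain v where v: "v \<in> S" "x = g v" using x by blast
      note i = S_idx[OF v(1)]
      have "idx x = k" using idx_eq k x by blast
      moreover have "idx (rep j) = j" if "j \<in> pverts G" for j
        using that idx_eq rep_in by blast
      ultimately show ?thesis
        using v i nb_in[OF i(1)] by (auto simp: g_def split: if_splits)
    qed
    show "\<not> V k \<subseteq> ?T"
    proof (cases "V k \<subseteq> S \<or> S \<inter> V k = {}")
      case True
      obtain x where "x \<in> V k" "x \<noteq> rep k"
        using ex_other[OF k] .
      then show ?thesis using T_cases True by blast
    next
      case False
      then show ?thesis using T_cases by blast
    qed
  qed
  moreover have "card ?T \<le> card S"
    using S_sub finite_H finite_subset by (intro card_image_le) blast
  ultimately show thesis by (rule that)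
qed

section \<open>Total domination in the product and in the base graph\<close>

lemma total_dominating_set_project:
  assumes dom: "total_dominating_set H S"
  obtains D where "total_dominating_set G D" "card D \<le> card S"
proof -
  have S_sub: "S \<subseteq> pverts H"
    using dom by (simp add: total_dominating_set_def)
  have S_idx: "idx v \<in> pverts G" "v \<in> V (idx v)" if "v \<in> S" for v
    using that S_sub by (auto simp: verts_H)
  define c where "c i = (SOME x. x \<in> S \<and> idx x = i)" for i
  have c: "c (idx v) \<in> S" "idx (c (idx v)) = idx v" if "v \<in> S" for v
    using someI[of "\<lambda>x. x \<in> S \<and> idx x = idx v" v] that by (auto simp: c_def)
  \<comment> \<open>The marked vertex \<open>c i\<close> of a block met by \<open>S\<close> accounts
    for \<open>i\<close> itself, any further vertex of \<open>S\<close> in that block for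
    \<open>nb i\<close>.\<close>
  define h where "h v = (if v = c (idx v) then idx v else nb (idx v))" for v
  let ?D = "h ` S"
  have idx_D: "idx v \<in> ?D" if "v \<in> S" for v
  proof -
    have "h (c (idx v)) = idx v"
      using c[OF that] by (simp add: h_def)
    then show ?thesis
      using c[OF that] by (metis imageI)
  qed
  have "?D \<subseteq> pverts G"
    using S_idx nb_in by (auto simp: h_def)
  moreover have "\<exists>j\<in>?D. (k, j) \<in> parcs G" if k: "k \<in> pverts G" for k
  proof -
    have dom': "\<exists>u\<in>S. (v, u) \<in> parcs H" if "v \<in> V k" for v
      using that dom k idx_eq by (simp add: total_dominating_set_def verts_H)
    \<comment> \<open>At most one of \<open>u\<close> and \<open>w\<close> is marked; the other is
      sent to \<open>nb k\<close>.\<close>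
    have two: "nb k \<in> ?D" if "u \<in> S" "w \<in> S" "u \<noteq> w" "idx u = k" "idx w = k" for u w
      using that by (metis h_def imageI)
    obtain u where u: "u \<in> S" "(rep k, u) \<in> parcs H"
      using dom' rep_in k by blast
    have idx_rep: "idx (rep k) = k"
      using idx_eq rep_in k by blast
    from u(2) show ?thesis
    proof (cases rule: arc_HE)
      case between
      then show ?thesis using idx_D[OF u(1)] idx_rep by metis
    next
      case inside
      then have idx_u: "idx u = k" using idx_rep by simp
      \<comment> \<open>Domination inside the block yields no arc of \<open>G\<close>, so the
        dominator of \<open>u\<close> itself is examined: it lies in an adjacent block, or it is a
        second vertex of \<open>S\<close> in \<open>V k\<close>.\<close>
      then obtain w where w: "w \<in> S" "(u, w) \<in> parcs H"
        using dom' S_idx u by blast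
      from w(2) show ?thesis
      proof (cases rule: arc_HE)
        case between
        then show ?thesis using idx_D[OF w(1)] idx_u by metis
      next
        case inside
        interpret Fk: pair_graph "F k" using k by (rule graph_F)
        have "u \<noteq> w" using inside idx_u Fk.no_loops' by auto
        then have "nb k \<in> ?D" using two u w inside idx_u by auto
        then show ?thesis using arc_nb k by blast
      qed
    qed
  qed
  ultimately have "total_dominating_set G ?D"
    by (simp add: total_dominating_set_def)
  moreover have "card ?D \<le> card S"
    using S_sub finite_H finite_subset by (intro card_image_le) blast
  ultimately show thesis by (rule that)
qed

lemma total_dominating_set_lift:
  assumes dom: "total_dominating_set G D"
  obtains T where "total_dominating_set H T" "thin T" "card T \<le> card D"
proof -
  have D_sub: "D \<subseteq> pverts G"
    using dom by (simp add: total_dominating_set_def)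
  have idx_rep: "idx (rep i) = i" if "i \<in> pverts G" for i
    using that idx_eq rep_in by blast
  let ?T = "rep ` D"
  have "?T \<subseteq> pverts H"
    using D_sub idx_rep rep_in by (auto simp: verts_H)
  moreover have "\<exists>u\<in>?T. (v, u) \<in> parcs H" if v: "v \<in> pverts H" for v
  proof -
    obtain j where "j \<in> D" "(idx v, j) \<in> parcs G"
      using v dom by (auto simp: total_dominating_set_def verts_H)
    moreover from this have "(v, rep j) \<in> parcs H"
      using v D_sub rep_in arc_H_between verts_H by blast
    ultimately show ?thesis by blast
  qed
  ultimately have "total_dominating_set H ?T"
    by (simp add: total_dominating_set_def)
  moreover have "thin ?T"
    unfolding thin_def
  proof
    fix k assume k: "k \<in> pverts G"
    obtain x where x: "x \<in> V k" "x \<noteq> rep k"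
      using ex_other[OF k] .
    have "x \<notin> ?T"
      using x k D_sub idx_rep idx_eq by (metis imageE subsetD)
    with x show "\<not> V k \<subseteq> ?T" by blast
  qed
  moreover have "card ?T \<le> card D"
    using D_sub G.pair_finite_verts finite_subset by (intro card_image_le) blast
  ultimately show thesis by (rule that)
qed

section \<open>Equality of the domination numbers\<close>

lemma dom_number_eq: "\<gamma> H = \<gamma>\<^sub>r H" "\<gamma> H = \<gamma>\<^sup>o\<^sup>c H"
  unfolding dom_number_def restrained_dom_number_def oc_dom_number_def
  by (rule min_card_subpredicate_eq[where R = thin];
      blast intro: thin_restrained thin_outer_connected elim: dominating_set_thin)+

text \<open>The set is projected to \<open>G\<close> and lifted back; neither passage increases its
  size.\<close>

lemma total_dominating_set_thin:
  assumes "total_dominating_set H S"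
  shows "\<exists>T. total_dominating_set H T \<and> thin T \<and> card T \<le> card S"
  using assms by (meson le_trans total_dominating_set_lift total_dominating_set_project)

lemma total_dom_number_eq: "\<gamma>\<^sub>t H = \<gamma>\<^sub>t\<^sub>r H" "\<gamma>\<^sub>t H = \<gamma>\<^sub>t\<^sup>o\<^sup>c H"
  unfolding total_dom_number_def total_restrained_dom_number_def total_oc_dom_number_def
  by (rule min_card_subpredicate_eq[where R = thin];
      blast intro: thin_restrained thin_outer_connected total_dominating_set_thin)+

lemma total_dom_number_base: "\<gamma>\<^sub>t G = \<gamma>\<^sub>t H"
  unfolding total_dom_number_def
proof (rule antisym)
  show "min_card (total_dominating_set G) \<le> min_card (total_dominating_set H)"
    by (rule min_card_le) (blast elim: total_dominating_set_project)
  show "min_card (total_dominating_set H) \<le> min_card (total_dominating_set G)"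
    by (rule min_card_le) (blast elim: total_dominating_set_lift)
qed

end

theorem theorem2p7:
  fixes n :: nat
    and G :: "nat pair_pre_digraph"
    and F :: "nat \<Rightarrow> 'a pair_pre_digraph"
  assumes "n \<ge> 2"
    and "pair_graph G"
    and "pverts G = {1..n}"
    and "Digraph_Component.connected (with_proj G)"
    and "\<And>i. i \<in> {1..n} \<Longrightarrow> pair_graph (F i)"
    and "disjoint_family_on (\<lambda>i. pverts (F i)) {1..n}"
    and "\<And>i. i \<in> {1..n} \<Longrightarrow> card (pverts (F i)) \<ge> 2"
  shows "(\<gamma> (lex_product G F) = \<gamma>\<^sub>r (lex_product G F) \<and>
          \<gamma>\<^sub>r (lex_product G F) = \<gamma>\<^sup>o\<^sup>c (lex_product G F)) \<and>
         (\<gamma>\<^sub>t G = \<gamma>\<^sub>t (lex_product G F) \<and>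
          \<gamma>\<^sub>t (lex_product G F) = \<gamma>\<^sub>t\<^sub>r (lex_product G F) \<and>
          \<gamma>\<^sub>t\<^sub>r (lex_product G F) = \<gamma>\<^sub>t\<^sup>o\<^sup>c (lex_product G F))"
proof -
  interpret lex_product_graph G F
    using assms by (intro lex_product_graph.intro) simp_all
  show ?thesis
    using dom_number_eq total_dom_number_base total_dom_number_eq by simp
qed

end
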